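(* Let $\mathcal A$ be a real symmetric tensor of order $m$ and dimension $n$, and let $\{x_k\}$ be the sequence generated by the General Descent Algorithm (described in the context) with a sequence $\{B_k\}$ of symmetric positive definite matrices in $\mathbb R^{n\times n}$. Suppose that there are constants $0<c\le M$ such that, for all $k$, $$c\|d\|^2\le d^TB_kd\le M\|d\|^2,\qquad\forall d\in\mathbb R^n.$$ Then every accumulation point $\bar x$ of $\{x_k\}$ is a $Z$-eigenvector of $\mathcal A$ corresponding to the $Z$-eigenvalue $\bar\lambda=\mathcal A\bar x^m$.
   Context: Let $m\ge 2$ and $n$ be positive integers, and let $\mathcal A=(a_{i_1\ldots i_m})$, $1\le i_1,\ldots,i_m\le n$, be a real symmetric tensor (entries invariant under permutation of indices). For $x\in\mathbb R^n$, $\mathcal A x^{m-1}\in\mathbb R^n$ has $i$-th entry $\sum_{i_2,\ldots,i_m}a_{ii_2\ldots i_m}x_{i_2}\cdots x_{i_m}$, and $\mathcal A x^m=x^T(\mathcal A x^{m-1})\in\mathbb R$. $\|\cdot\|$ is the Euclidean norm and $\mathbb B=\{x\in\mathbb R^n: x^Tx=1\}$. A vector $x$ is a $Z$-eigenvector of $\mathcal A$ with $Z$-eigenvalue $\lambda\in\mathbb R$ if $\mathcal A x^{m-1}=\lambda x$ and $x^Tx=1$. Let $\phi(x)=\frac1m\mathcal A x^m$, so $\nabla\phi(x)=\mathcal A x^{m-1}$, and $F(x)=\mathcal A x^{m-1}-(\mathcal A x^m)\,x$; for $x\in\mathbb B$, $F(x)=(I-xx^T)\nabla\phi(x)$. General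 Descent Algorithm (for $\min_{x\in\mathbb B}\phi(x)$). Fix $\sigma\in(0,1)$, $\rho\in(0,1)$, $x_0\in\mathbb B$ and a sequence $\{B_k\}$ of symmetric positive definite matrices. For $k=0,1,\ldots$, while $F(x_k)\ne0$: let $d_k=-B_k^{-1}(I-x_kx_k^T)\nabla\phi(x_k)$ and $x_k(\alpha)=\frac{x_k+\alpha d_k}{\|x_k+\alpha d_k\|}$; find by backtracking the largest $\alpha_k\in\{1,\rho,\rho^2,\ldots\}$ satisfying $\phi(x_k(\alpha_k))\le\phi(x_k)-\sigma\alpha_k[F(x_k)]^TB_k^{-1}F(x_k)$; let $x_{k+1}=x_k(\alpha_k)$. The statement concerns the case in which the algorithm generates an infinite sequence. *)

theory Defs
  imports "HOL-Analysis.Analysis"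
begin

text \<open>
  A real tensor of order \<open>m\<close> and dimension \<open>CARD('n)\<close> is given by its entries, indexed by
  the lists of length \<open>m\<close> over \<open>'n\<close>; the values at lists of any other length are irrelevant.
\<close>

type_synonym 'n tensor = "'n list \<Rightarrow> real"

definition symmetric_tensor :: "nat \<Rightarrow> 'n tensor \<Rightarrow> bool" where
  "symmetric_tensor m A \<longleftrightarrow>
     (\<forall>js ks. length js = m \<longrightarrow> length ks = m \<longrightarrow> mset js = mset ks \<longrightarrow> A js = A ks)"

definition tensor_vec :: "nat \<Rightarrow> 'n::finite tensor \<Rightarrow> real ^ 'n \<Rightarrow> real ^ 'n" where
  "tensor_vec m A x =
     (\<chi> i. \<Sum>js\<in>{js. length js = m - 1}. A (i # js) * (\<Prod>j\<leftarrow>js. x $ j))"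

definition tensor_form :: "nat \<Rightarrow> 'n::finite tensor \<Rightarrow> real ^ 'n \<Rightarrow> real" where
  "tensor_form m A x = x \<bullet> tensor_vec m A x"

definition Z_eigenvector :: "nat \<Rightarrow> 'n::finite tensor \<Rightarrow> real \<Rightarrow> real ^ 'n \<Rightarrow> bool" where
  "Z_eigenvector m A lam x \<longleftrightarrow> tensor_vec m A x = lam *\<^sub>R x \<and> x \<bullet> x = 1"

definition phi :: "nat \<Rightarrow> 'n::finite tensor \<Rightarrow> real ^ 'n \<Rightarrow> real" where
  "phi m A x = 1 / real m * tensor_form m A x"

definition gradient :: "('a::real_inner \<Rightarrow> real) \<Rightarrow> 'a \<Rightarrow> 'a" where
  "gradient f x = (THE g. GDERIV f x :> g)"

definition F_map :: "nat \<Rightarrow> 'n::finite tensor \<Rightarrow> real ^ 'n \<Rightarrow> real ^ 'n" where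
  "F_map m A x = tensor_vec m A x - tensor_form m A x *\<^sub>R x"

definition symmetric_pos_def :: "real ^ 'n ^ 'n \<Rightarrow> bool" where
  "symmetric_pos_def B \<longleftrightarrow> transpose B = B \<and> (\<forall>d. d \<noteq> 0 \<longrightarrow> d \<bullet> (B *v d) > 0)"

definition outer_product :: "real ^ 'n \<Rightarrow> real ^ 'n \<Rightarrow> real ^ 'n ^ 'n" where
  "outer_product x y = (\<chi> i j. x $ i * y $ j)"

definition descent_direction ::
    "nat \<Rightarrow> 'n::finite tensor \<Rightarrow> real ^ 'n ^ 'n \<Rightarrow> real ^ 'n \<Rightarrow> real ^ 'n" where
  "descent_direction m A B x =
     - (matrix_inv B *v ((mat 1 - outer_product x x) *v gradient (phi m A) x))"

definition trial_point ::
    "nat \<Rightarrow> 'n::finite tensor \<Rightarrow> real ^ 'n ^ 'n \<Rightarrow> real ^ 'n \<Rightarrow> real \<Rightarrow> real ^ 'n" where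
  "trial_point m A B x \<alpha> =
     (let y = x + \<alpha> *\<^sub>R descent_direction m A B x in y /\<^sub>R norm y)"

definition sufficient_decrease ::
    "nat \<Rightarrow> 'n::finite tensor \<Rightarrow> real \<Rightarrow> real ^ 'n ^ 'n \<Rightarrow> real ^ 'n \<Rightarrow> real \<Rightarrow> bool" where
  "sufficient_decrease m A \<sigma> B x \<alpha> \<longleftrightarrow>
     phi m A (trial_point m A B x \<alpha>)
       \<le> phi m A x - \<sigma> * \<alpha> * (F_map m A x \<bullet> (matrix_inv B *v F_map m A x))"

definition backtracking_step ::
    "nat \<Rightarrow> 'n::finite tensor \<Rightarrow> real \<Rightarrow> real \<Rightarrow> real ^ 'n ^ 'n \<Rightarrow> real ^ 'n \<Rightarrow> real \<Rightarrow> bool" where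
  "backtracking_step m A \<sigma> \<rho> B x \<alpha> \<longleftrightarrow>
     \<alpha> \<in> range (\<lambda>j::nat. \<rho> ^ j) \<and> sufficient_decrease m A \<sigma> B x \<alpha> \<and>
     (\<forall>\<beta>\<in>range (\<lambda>j::nat. \<rho> ^ j). sufficient_decrease m A \<sigma> B x \<beta> \<longrightarrow> \<beta> \<le> \<alpha>)"

text \<open>
  An infinite run of the algorithm: the stopping test \<open>F_map m A (x k) = 0\<close> never succeeds.
\<close>

definition general_descent_run ::
    "nat \<Rightarrow> 'n::finite tensor \<Rightarrow> real \<Rightarrow> real \<Rightarrow> (nat \<Rightarrow> real ^ 'n ^ 'n) \<Rightarrow> (nat \<Rightarrow> real ^ 'n) \<Rightarrow> bool"
  where
  "general_descent_run m A \<sigma> \<rho> B x \<longleftrightarrow>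
     x 0 \<bullet> x 0 = 1 \<and>
     (\<forall>k. F_map m A (x k) \<noteq> 0 \<and>
          (\<exists>\<alpha>. backtracking_step m A \<sigma> \<rho> (B k) (x k) \<alpha> \<and>
               x (Suc k) = trial_point m A (B k) (x k) \<alpha>))"

definition accumulation_point :: "(nat \<Rightarrow> 'a::topological_space) \<Rightarrow> 'a \<Rightarrow> bool" where
  "accumulation_point x p \<longleftrightarrow> (\<exists>r::nat \<Rightarrow> nat. strict_mono r \<and> (x \<circ> r) \<longlonglongrightarrow> p)"

end

theory Submission
  imports Defs
begin

text \<open>
  On the sphere the algorithm is a backtracking line search for the function
  \<open>y \<mapsto> phi (y / norm y)\<close>, whose gradient \<open>F (y / norm y) / norm y\<close> is continuous away from \<open>0\<close>.
  If \<open>F xbar\<close> were nonzero, strict differentiability at \<open>xbar\<close> together with the uniform bounds on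
  the \<open>B k\<close> would make every sufficiently short step from a point near \<open>xbar\<close> acceptable, so the
  accepted steps near \<open>xbar\<close> would be bounded below, and \<open>phi\<close> would drop by a fixed amount
  infinitely often.  But \<open>phi\<close> decreases along the run and stays above \<open>phi xbar\<close>.
\<close>

section \<open>Tensor forms as polynomials: recursion on the order, continuity\<close>

text \<open>This is A x^k as a flat sum over index lists. The order \<open>k\<close> is independent
  of the fixed \<open>m\<close>, so fixing the first index gives a form of order one less and
  permits induction on the order.\<close>

definition full_form :: "nat \<Rightarrow> 'n::finite tensor \<Rightarrow> real ^ 'n \<Rightarrow> real" where
  "full_form k A x = (\<Sum>js\<in>{js. length js = k}. A js * (\<Prod>j\<leftarrow>js. x $ j))"

lemma full_form_0: "full_form 0 A x = A []"
  by (simp add: full_form_def)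

lemma full_form_Suc:
  "full_form (Suc k) A x = (\<Sum>i\<in>UNIV. x $ i * full_form k (\<lambda>js. A (i # js)) x)"
proof -
  have "full_form (Suc k) A x =
      (\<Sum>(i, js)\<in>UNIV \<times> {js. length js = k}. x $ i * (A (i # js) * (\<Prod>j\<leftarrow>js. x $ j)))"
    unfolding full_form_def
    by (rule sum.reindex_bij_witness[where i = "\<lambda>(i, js). i # js" and j = "\<lambda>l. (hd l, tl l)"])
      (auto simp: length_Suc_conv)
  then show ?thesis
    by (simp add: full_form_def sum_distrib_left flip: sum.cartesian_product)
qed

lemma tensor_vec_nth: "tensor_vec m A x $ i = full_form (m - 1) (\<lambda>js. A (i # js)) x"
  by (simp add: tensor_vec_def full_form_def)

lemma tensor_form_eq_full_form:
  assumes "m \<ge> 1"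
  shows "tensor_form m A x = full_form m A x"
  using assms full_form_Suc[of "m - 1" A x]
  by (simp add: tensor_form_def inner_vec_def tensor_vec_nth)

lemma continuous_on_full_form: "continuous_on S (full_form k A)"
  unfolding full_form_def
proof (intro continuous_intros)
  fix js :: "'a list"
  show "continuous_on S (\<lambda>x. \<Prod>j\<leftarrow>js. x $ j)"
    by (induction js) (auto intro!: continuous_intros)
qed

lemma continuous_on_tensor_vec: "continuous_on S (tensor_vec m A)"
proof -
  have "tensor_vec m A = (\<lambda>x. \<chi> i. full_form (m - 1) (\<lambda>js. A (i # js)) x)"
    by (simp add: fun_eq_iff vec_eq_iff tensor_vec_nth)
  then show ?thesis
    by (simp add: continuous_on_vec_lambda continuous_on_full_form)
qed

lemma continuous_on_F_map: "continuous_on S (F_map m A)"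
  unfolding F_map_def tensor_form_def
  by (intro continuous_intros continuous_on_tensor_vec)

section \<open>Derivatives: of the form, of \<open>phi\<close>, and of \<open>phi\<close> after
  normalisation\<close>

lemma symmetric_tensor_slice:
  assumes "symmetric_tensor (Suc k) A"
  shows "symmetric_tensor k (\<lambda>js. A (i # js))"
  unfolding symmetric_tensor_def
proof (intro allI impI)
  fix js ks :: "'a list"
  assume "length js = k" "length ks = k" "mset js = mset ks"
  then show "A (i # js) = A (i # ks)"
    using assms unfolding symmetric_tensor_def
    by (metis length_Cons mset.simps(2))
qed

lemma symmetric_tensor_swap:
  assumes "symmetric_tensor (Suc (Suc k)) A" "length js = k"
  shows "A (i # j # js) = A (j # i # js)"
  by (rule assms(1)[unfolded symmetric_tensor_def, rule_format])
    (simp_all add: assms(2) add_mset_commute)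

text \<open>Splitting off the first index, the product rule gives one copy of the slice sum from the
  factors \<open>x $ i\<close>. By induction the slices contribute \<open>k\<close> further copies,
  once symmetry has exchanged the first two indices.\<close>

lemma has_derivative_full_form:
  assumes "symmetric_tensor k A"
  shows "(full_form k A has_derivative
      (\<lambda>h. real k * (\<Sum>i\<in>UNIV. h $ i * full_form (k - 1) (\<lambda>js. A (i # js)) x))) (at x)"
  using assms
proof (induction k arbitrary: A)
  case 0
  show ?case
    by (simp add: full_form_0[abs_def])
next
  case (Suc k)
  let ?S = "\<lambda>i js. A (i # js)"
  have "((\<lambda>x. \<Sum>i\<in>UNIV. x $ i * full_form k (?S i) x) has_derivative
      (\<lambda>h. \<Sum>i\<in>UNIV. x $ i *
          (real k * (\<Sum>j\<in>UNIV. h $ j * full_form (k - 1) (\<lambda>js. A (i # j # js)) x))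
        + h $ i * full_form k (?S i) x)) (at x)"
    by (intro has_derivative_sum has_derivative_mult Suc.IH symmetric_tensor_slice Suc.prems
        bounded_linear_imp_has_derivative bounded_linear_vec_nth)
  moreover have "(\<Sum>i\<in>UNIV. x $ i *
          (real k * (\<Sum>j\<in>UNIV. h $ j * full_form (k - 1) (\<lambda>js. A (i # j # js)) x)))
        = real k * (\<Sum>i\<in>UNIV. h $ i * full_form k (?S i) x)" for h
  \<comment> \<open>For \<open>k = 0\<close> the factor \<open>real k\<close> vanishes, so the
    truncated \<open>k - 1\<close> is harmless.\<close>
  proof (cases k)
    case 0
    then show ?thesis by simp
  next
    case (Suc l)
    have sw: "full_form l (\<lambda>js. A (i # j # js)) x = full_form l (\<lambda>js. A (j # i # js)) x" for i j
      unfolding full_form_def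
      using symmetric_tensor_swap[of l A] Suc.prems Suc by (intro sum.cong) auto
    have "(\<Sum>i\<in>UNIV. x $ i * (real k * (\<Sum>j\<in>UNIV. h $ j * full_form l (\<lambda>js. A (i # j # js)) x)))
        = (\<Sum>i\<in>UNIV. \<Sum>j\<in>UNIV. real k * (h $ j * (x $ i * full_form l (\<lambda>js. A (j # i # js)) x)))"
      by (simp add: sum_distrib_left mult_ac sw)
    also have "\<dots> = (\<Sum>j\<in>UNIV. \<Sum>i\<in>UNIV. real k * (h $ j * (x $ i * full_form l (\<lambda>js. A (j # i # js)) x)))"
      by (rule sum.swap)
    also have "\<dots> = real k * (\<Sum>j\<in>UNIV. h $ j * full_form k (?S j) x)"
      unfolding Suc full_form_Suc by (simp add: sum_distrib_left)
    finally show ?thesis by (simp add: Suc)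
  qed
  ultimately show ?case
    by (simp add: full_form_Suc[abs_def] sum.distrib distrib_right add.commute)
qed

lemma GDERIV_phi:
  assumes "m \<ge> 1" "symmetric_tensor m A"
  shows "GDERIV (phi m A) x :> tensor_vec m A x"
proof -
  have "phi m A = (\<lambda>x. 1 / real m * full_form m A x)"
    using assms by (simp add: fun_eq_iff phi_def tensor_form_eq_full_form)
  moreover have "((\<lambda>x. 1 / real m * full_form m A x) has_derivative
      (\<lambda>h. 1 / real m * (real m * (\<Sum>i\<in>UNIV. h $ i * full_form (m - 1) (\<lambda>js. A (i # js)) x)))) (at x)"
    by (intro has_derivative_mult_right has_derivative_full_form assms)
  ultimately show ?thesis
    using assms(1) by (simp add: gderiv_def inner_vec_def tensor_vec_nth)
qed

lemma gradient_eqI: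
  assumes "GDERIV f x :> g"
  shows "gradient f x = g"
  unfolding gradient_def
proof (rule the_equality)
  fix g' assume "GDERIV f x :> g'"
  then have "(\<lambda>h. h \<bullet> g') = (\<lambda>h. h \<bullet> g)"
    using assms unfolding gderiv_def by (rule has_derivative_unique)
  then have "\<forall>h. h \<bullet> g' = h \<bullet> g"
    by (simp add: fun_eq_iff)
  then show "g' = g"
    by (simp only: vector_eq_ldot)
qed (fact assms)

lemma outer_product_mult_vec: "outer_product x y *v z = (y \<bullet> z) *\<^sub>R x"
  by (simp add: vec_eq_iff matrix_vector_mult_def outer_product_def inner_vec_def
      sum_distrib_left mult_ac)

text \<open>Projecting the gradient with I - x x^T subtracts exactly
  \<open>tensor_form m A x *\<^sub>R x\<close>, so the identity holds off the sphere as
  well.\<close>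

lemma descent_direction_eq:
  assumes "m \<ge> 1" "symmetric_tensor m A"
  shows "descent_direction m A B x = - (matrix_inv B *v F_map m A x)"
  unfolding descent_direction_def gradient_eqI[OF GDERIV_phi[OF assms]]
  by (simp add: matrix_vector_mult_diff_rdistrib outer_product_mult_vec F_map_def tensor_form_def)

text \<open>The derivative of y / |y| discards the component along y and divides by |y|; moved to
  the other side of the inner product, this projection turns \<open>tensor_vec\<close> into
  \<open>F_map\<close>.\<close>

lemma has_derivative_phi_normalized:
  fixes y :: "real ^ 'n"
  assumes "m \<ge> 1" "symmetric_tensor m A" "y \<noteq> 0"
  shows "((\<lambda>y. phi m A (y /\<^sub>R norm y)) has_derivative
      (\<lambda>h. h \<bullet> (F_map m A (y /\<^sub>R norm y) /\<^sub>R norm y))) (at y)"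
proof -
  let ?z = "y /\<^sub>R norm y"
  have "((\<lambda>y. y /\<^sub>R norm y) has_derivative
      (\<lambda>h. inverse (norm y) *\<^sub>R h + (- (inverse (norm y) * (h \<bullet> sgn y) * inverse (norm y))) *\<^sub>R y)) (at y)"
    by (rule has_derivative_scaleR[OF Deriv.has_derivative_inverse[OF _ has_derivative_norm[OF assms(3)]]
          has_derivative_ident]) (simp add: assms(3))
  moreover have "(phi m A has_derivative (\<lambda>h. h \<bullet> tensor_vec m A ?z)) (at ?z)"
    using GDERIV_phi[OF assms(1,2)] by (simp add: gderiv_def)
  ultimately have "((\<lambda>y. phi m A (y /\<^sub>R norm y)) has_derivative
      (\<lambda>h. (inverse (norm y) *\<^sub>R h + (- (inverse (norm y) * (h \<bullet> sgn y) * inverse (norm y))) *\<^sub>R y)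
        \<bullet> tensor_vec m A ?z)) (at y)"
    by (rule has_derivative_compose)
  then show ?thesis
    by (simp add: F_map_def tensor_form_def sgn_div_norm inner_diff_right inner_left_distrib
        algebra_simps)
qed

text \<open>Near \<open>p\<close> the derivative of f minus its linearisation at \<open>p\<close>
  has norm at most \<epsilon>, so the mean value inequality applies on a ball. Both end points are
  free: the iterates start from moving points while the linear model stays fixed at
  \<open>p\<close>.\<close>

lemma strict_differentiability:
  fixes f :: "'a::real_inner \<Rightarrow> real"
  assumes "0 < r" "0 < \<epsilon>"
    and deriv: "\<And>y. y \<in> ball p r \<Longrightarrow> (f has_derivative (\<lambda>h. h \<bullet> g y)) (at y)"
    and cont: "isCont g p"
  obtains \<delta> where "0 < \<delta>"
    "\<And>x y. x \<in> ball p \<delta> \<Longrightarrow> y \<in> ball p \<delta> \<Longrightarrow> \<bar>f y - f x - (y - x) \<bullet> g p\<bar> \<le> \<epsilon> * norm (y - x)"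
proof -
  obtain d where d: "0 < d" "\<And>y. dist y p < d \<Longrightarrow> dist (g y) (g p) < \<epsilon>"
    using cont \<open>0 < \<epsilon>\<close> unfolding continuous_at_eps_delta by (meson dist_commute)
  define \<delta> where "\<delta> = min d r"
  have pos: "0 < \<delta>" using d(1) assms(1) by (simp add: \<delta>_def)
  have "norm (f y - f x - (y - x) \<bullet> g p) \<le> norm (y - x) * \<epsilon>"
    if xy: "x \<in> ball p \<delta>" "y \<in> ball p \<delta>" for x y
  proof (rule differentiable_bound_linearization[where S = "ball p \<delta>" and f' = "\<lambda>z h. h \<bullet> g z"])
    show "x + t *\<^sub>R (y - x) \<in> ball p \<delta>" if "t \<in> {0..1}" for t
    proof -
      have "x + t *\<^sub>R (y - x) = (1 - t) *\<^sub>R x + t *\<^sub>R y" by (simp add: algebra_simps)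
      then show ?thesis
        using convexD_alt[OF convex_ball xy, of t] that by simp
    qed
    show "(f has_derivative (\<lambda>h. h \<bullet> g z)) (at z within ball p \<delta>)" if "z \<in> ball p \<delta>" for z
      using that by (intro has_derivative_at_withinI[OF deriv]) (simp add: \<delta>_def)
    show "onorm ((\<lambda>h. h \<bullet> g z) - (\<lambda>h. h \<bullet> g p)) \<le> \<epsilon>" if "z \<in> ball p \<delta>" for z
    proof (rule onorm_bound)
      show "0 \<le> \<epsilon>" using assms(2) by simp
      fix h
      have "norm (g z - g p) \<le> \<epsilon>"
        using d(2)[of z] that by (simp add: \<delta>_def dist_norm norm_minus_commute less_imp_le)
      then have "\<bar>h \<bullet> (g z - g p)\<bar> \<le> norm h * \<epsilon>"
        by (meson Cauchy_Schwarz_ineq2 mult_left_mono norm_ge_zero order_trans)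
      then show "norm (((\<lambda>h. h \<bullet> g z) - (\<lambda>h. h \<bullet> g p)) h) \<le> \<epsilon> * norm h"
        by (simp add: inner_diff_right mult.commute)
    qed
  qed (simp add: pos)
  then show thesis
    using that[OF pos] by (simp add: mult.commute)
qed

section \<open>Bounds for inverses of positive definite matrices\<close>

text \<open>\<open>matrix_inv\<close> is defined by choice, so invertibility has to come first;
  definiteness supplies it through injectivity.\<close>

lemma symmetric_pos_def_mult_inv:
  assumes "symmetric_pos_def B"
  shows "B *v (matrix_inv B *v v) = v"
proof -
  have "inj ((*v) B)"
  proof (rule injI)
    fix u w assume "B *v u = B *v w"
    then have "(u - w) \<bullet> (B *v (u - w)) = 0"
      by (simp add: matrix_vector_mult_diff_distrib)
    then show "u = w"
      using assms unfolding symmetric_pos_def_def by (metis less_irrefl right_minus_eq)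
  qed
  then have "invertible B"
    by (simp add: invertible_left_inverse matrix_left_invertible_injective)
  then have "B ** matrix_inv B = mat 1"
    unfolding invertible_def matrix_inv_def by (rule someI2_ex) simp
  then show ?thesis
    by (simp add: matrix_vector_mul_assoc)
qed

text \<open>In spectral terms, B \<le> M I implies B^(-1) \<ge> (1/M) I. This bounds the predicted
  decrease below by the norm of \<open>F_map\<close>. Instead of eigenvalues, the proof evaluates
  the form of \<open>B\<close> at a single vector.\<close>

lemma inner_matrix_inv_ge:
  fixes B :: "real ^ 'n ^ 'n"
  assumes "symmetric_pos_def B" "0 < M" and M: "\<And>d. d \<bullet> (B *v d) \<le> M * (norm d)\<^sup>2"
  shows "(norm v)\<^sup>2 \<le> M * (v \<bullet> (matrix_inv B *v v))"
proof -
  define e where "e = matrix_inv B *v v"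
  have Be: "B *v e = v"
    unfolding e_def by (rule symmetric_pos_def_mult_inv[OF assms(1)])
  \<comment> \<open>Settles the cross term: symmetry moves \<open>B\<close> onto \<open>e\<close>,
    and \<open>B *v e = v\<close>.\<close>
  have sym: "e \<bullet> (B *v v) = v \<bullet> v"
    using assms(1) dot_lmul_matrix[of e B v] Be
    by (simp add: symmetric_pos_def_def flip: transpose_matrix_vector)
  \<comment> \<open>up to scaling, the minimiser of \<open>(e - t v) \<bullet> B (e - t v)\<close> when \<open>v \<bullet> B v\<close> is replaced by its bound \<open>M (norm v)\<^sup>2\<close>\<close>
  define u where "u = M *\<^sub>R e - v"
  have "0 \<le> u \<bullet> (B *v u)"
    using assms(1) unfolding symmetric_pos_def_def by (cases "u = 0") (auto intro: less_imp_le)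
  also have "u \<bullet> (B *v u) = M * (M * (v \<bullet> e)) - 2 * M * (v \<bullet> v) + v \<bullet> (B *v v)"
    using sym
    by (simp add: u_def matrix_vector_mult_diff_distrib matrix_vector_mult_scaleR Be
        inner_diff_left inner_diff_right inner_commute algebra_simps)
  also have "\<dots> \<le> M * (M * (v \<bullet> e)) - M * (v \<bullet> v)"
    using M[of v] by (simp add: power2_norm_eq_inner)
  finally have "M * (v \<bullet> v) \<le> M * (M * (v \<bullet> e))" by simp
  then show ?thesis
    using \<open>0 < M\<close> by (simp add: e_def power2_norm_eq_inner)
qed

section \<open>The iterates stay on the unit sphere\<close>

lemma norm_trial_point:
  assumes "trial_point m A B x \<alpha> \<noteq> 0"
  shows "norm (trial_point m A B x \<alpha>) = 1"
  using assms by (auto simp: trial_point_def Let_def)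

text \<open>For m \<ge> 2 every monomial has at least one factor; for m = 1 the empty product would
  leave a constant vector.\<close>

lemma F_map_0:
  assumes "m \<ge> 2"
  shows "F_map m A 0 = 0"
proof -
  have "(\<Prod>j\<leftarrow>js. (0 :: real ^ 'a) $ j) = 0" if "length js = m - 1" for js :: "'a list"
    using that assms by (cases js) auto
  then show ?thesis
    by (simp add: F_map_def tensor_form_def tensor_vec_def vec_eq_iff)
qed

lemma general_descent_run_norm:
  assumes "m \<ge> 2" "general_descent_run m A \<sigma> \<rho> B x"
  shows "norm (x k) = 1"
  \<comment> \<open>the junk value \<open>0 / norm 0 = 0\<close> of a trial point is excluded by \<open>F 0 = 0\<close>\<close>
proof (cases k)
  case 0
  then show ?thesis
    using assms(2) by (simp add: general_descent_run_def norm_eq_1)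
next
  case (Suc l)
  have "x k \<noteq> 0"
    using assms F_map_0[OF assms(1), of A] by (metis general_descent_run_def)
  then show ?thesis
    using assms(2) norm_trial_point unfolding general_descent_run_def Suc by metis
qed

section \<open>Uniform acceptance of short steps near a nonstationary point\<close>

text \<open>The bounds \<open>c\<close> and \<open>M\<close> control the search direction from both
  sides, so neither the threshold \<open>b\<close> nor the neighbourhood depends on the matrix.
  Since \<sigma> < 1, the first-order decrease leaves a margin that absorbs the linearisation
  errors.\<close>

lemma sufficient_decrease_near:
  fixes p :: "real ^ 'n"
  assumes "m \<ge> 1" "symmetric_tensor m A" "\<sigma> < 1" "0 < c" "c \<le> M"
    and "norm p = 1" "F_map m A p \<noteq> 0"
  obtains b where "0 < b"
    "\<forall>\<^sub>F y in nhds p. \<forall>B \<beta>. norm y = 1 \<longrightarrow> symmetric_pos_def B \<longrightarrow>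
       (\<forall>d. c * (norm d)\<^sup>2 \<le> d \<bullet> (B *v d) \<and> d \<bullet> (B *v d) \<le> M * (norm d)\<^sup>2) \<longrightarrow>
       0 < \<beta> \<longrightarrow> \<beta> < b \<longrightarrow> sufficient_decrease m A \<sigma> B y \<beta>"
proof -
  let ?F = "F_map m A"
  define \<psi> where "\<psi> y = phi m A (y /\<^sub>R norm y)" for y
  define g where "g y = ?F (y /\<^sub>R norm y) /\<^sub>R norm y" for y
  \<comment> \<open>Near \<open>p\<close> the norm of \<open>F_map\<close> will lie between \<eta>
    and 3\<eta>.\<close>
  define \<eta> where "\<eta> = norm (?F p) / 2"
  \<comment> \<open>Two errors of size \<epsilon> |e| must fit into (1 - \<sigma>) times
    \<open>e \<bullet> ?F y\<close>, which is at least c |e|^2, where |e| \<ge> \<eta> / M.\<close>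
  define \<epsilon> where "\<epsilon> = (1 - \<sigma>) * c * \<eta> / (2 * M)"
  have M: "0 < M" using assms by simp
  have \<eta>: "0 < \<eta>" using assms by (simp add: \<eta>_def)
  have \<epsilon>: "0 < \<epsilon>" using assms M \<eta> by (simp add: \<epsilon>_def)
  have Fcont: "isCont ?F z" for z
    using continuous_on_F_map[of UNIV m A] by (simp add: continuous_on_eq_continuous_at)
  have gp: "g p = ?F p" by (simp add: g_def assms(6))
  have gcont: "isCont g p"
    unfolding g_def using assms(6) by (auto intro!: continuous_intros isCont_o2[OF _ Fcont])
  \<comment> \<open>The unit ball around the unit vector \<open>p\<close> avoids the origin, where
    normalisation fails.\<close>
  have deriv: "(\<psi> has_derivative (\<lambda>h. h \<bullet> g y)) (at y)" if "y \<in> ball p 1" for y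
    unfolding \<psi>_def g_def
    using that assms(6) by (intro has_derivative_phi_normalized assms) (auto simp: dist_norm)
  obtain \<delta> where \<delta>: "0 < \<delta>"
    "\<And>x y. x \<in> ball p \<delta> \<Longrightarrow> y \<in> ball p \<delta> \<Longrightarrow> \<bar>\<psi> y - \<psi> x - (y - x) \<bullet> g p\<bar> \<le> \<epsilon> * norm (y - x)"
    using strict_differentiability[OF _ \<epsilon> deriv gcont] by (metis zero_less_one)
  \<comment> \<open>Since |e| < 3\<eta> / c, a step below \<open>b\<close> moves \<open>y\<close> by
    less than \<delta> / 2; with \<open>y\<close> itself within \<delta> / 2 of \<open>p\<close>,
    the new point stays in the ball.\<close>
  define b where "b = \<delta> * c / (6 * \<eta>)"
  have b: "0 < b" using \<delta> \<eta> assms by (simp add: b_def)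
  have "\<forall>\<^sub>F y in nhds p. dist (?F y) (?F p) < min \<epsilon> \<eta>"
    using Fcont[of p] \<epsilon> \<eta> unfolding isCont_def tendsto_at_iff_tendsto_nhds
    by (intro tendstoD) auto
  moreover have "\<forall>\<^sub>F y in nhds p. dist y p < \<delta> / 2"
    unfolding eventually_nhds_metric using \<delta>(1) half_gt_zero by blast
  ultimately have "\<forall>\<^sub>F y in nhds p. \<forall>B \<beta>. norm y = 1 \<longrightarrow> symmetric_pos_def B \<longrightarrow>
       (\<forall>d. c * (norm d)\<^sup>2 \<le> d \<bullet> (B *v d) \<and> d \<bullet> (B *v d) \<le> M * (norm d)\<^sup>2) \<longrightarrow>
       0 < \<beta> \<longrightarrow> \<beta> < b \<longrightarrow> sufficient_decrease m A \<sigma> B y \<beta>"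
  proof (eventually_elim, intro allI impI)
    fix y and B :: "real ^ 'n ^ 'n" and \<beta>
    assume Fy: "dist (?F y) (?F p) < min \<epsilon> \<eta>" and y: "dist y p < \<delta> / 2" "norm y = 1"
      and B: "symmetric_pos_def B"
      and cM: "\<forall>d. c * (norm d)\<^sup>2 \<le> d \<bullet> (B *v d) \<and> d \<bullet> (B *v d) \<le> M * (norm d)\<^sup>2"
      and \<beta>: "0 < \<beta>" "\<beta> < b"
    define e where "e = matrix_inv B *v ?F y"
    have Be: "B *v e = ?F y"
      unfolding e_def by (rule symmetric_pos_def_mult_inv[OF B])
    have ce: "c * (norm e)\<^sup>2 \<le> e \<bullet> ?F y"
      using cM Be by metis
    have "norm (?F y - ?F p) < \<eta>" "norm (?F p) = 2 * \<eta>"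
      using Fy by (auto simp: dist_norm \<eta>_def)
    then have Fb: "\<eta> < norm (?F y)" "norm (?F y) < 3 * \<eta>"
      using norm_triangle_ineq2[of "?F y" "?F p"] norm_triangle_ineq3[of "?F y" "?F p"] by linarith+
    have cs: "e \<bullet> ?F y \<le> norm e * norm (?F y)" by (rule norm_cauchy_schwarz)
    have "norm (?F y) * norm (?F y) \<le> M * (e \<bullet> ?F y)"
      using inner_matrix_inv_ge[OF B M, of "?F y"] cM
      by (simp add: e_def power2_eq_square inner_commute)
    also have "\<dots> \<le> (M * norm e) * norm (?F y)"
      using cs M by simp
    finally have "norm (?F y) \<le> M * norm e"
      by (rule mult_right_le_imp_le) (use Fb \<eta> in linarith)
    then have \<eta>e: "\<eta> \<le> M * norm e" using Fb by simp
    then have e0: "0 < norm e" using \<eta> M by (smt (verit) mult_nonneg_nonpos)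
    have "c * norm e * norm e \<le> norm (?F y) * norm e"
      using ce cs by (simp add: power2_eq_square mult_ac)
    then have "c * norm e \<le> norm (?F y)" using e0 by (rule mult_right_le_imp_le)
    then have "c * norm e < 3 * \<eta>" using Fb by simp
    then have "norm e < 3 * \<eta> / c" using assms(4) by (simp add: pos_less_divide_eq mult.commute)
    then have "\<beta> * norm e < b * (3 * \<eta> / c)"
      using \<beta> e0 by (intro mult_strict_mono) auto
    also have "\<dots> = \<delta> / 2" using \<eta> assms(4) by (simp add: b_def)
    finally have \<beta>e: "\<beta> * norm e < \<delta> / 2" .
    have "y - \<beta> *\<^sub>R e \<in> ball p \<delta>"
    proof -
      have "norm ((y - \<beta> *\<^sub>R e) - p) \<le> norm (y - p) + norm (\<beta> *\<^sub>R e)"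
        using norm_triangle_ineq4[of "y - p" "\<beta> *\<^sub>R e"] by (simp add: algebra_simps)
      then show ?thesis using y \<beta>e \<beta> by (simp add: dist_norm norm_minus_commute)
    qed
    moreover have "y \<in> ball p \<delta>" using y \<delta>(1) by (simp add: dist_commute)
    ultimately have "\<bar>\<psi> (y - \<beta> *\<^sub>R e) - \<psi> y - (- (\<beta> *\<^sub>R e)) \<bullet> ?F p\<bar> \<le> \<epsilon> * (\<beta> * norm e)"
      using \<delta>(2)[of y "y - \<beta> *\<^sub>R e"] \<beta> by (simp add: gp)
    then have "\<psi> (y - \<beta> *\<^sub>R e) \<le> \<psi> y - \<beta> * (e \<bullet> ?F p) + \<epsilon> * (\<beta> * norm e)"
      by simp
    \<comment> \<open>The second error: the linear model uses \<open>?F p\<close>, the line search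
      test uses \<open>?F y\<close>.\<close>
    moreover have "e \<bullet> ?F y - e \<bullet> ?F p \<le> \<epsilon> * norm e"
    proof -
      have "e \<bullet> (?F y - ?F p) \<le> norm e * norm (?F y - ?F p)" by (rule norm_cauchy_schwarz)
      also have "\<dots> \<le> norm e * \<epsilon>" using Fy by (intro mult_left_mono) (auto simp: dist_norm)
      finally show ?thesis by (simp add: inner_diff_right mult.commute)
    qed
    then have "\<beta> * (e \<bullet> ?F y - e \<bullet> ?F p) \<le> \<beta> * (\<epsilon> * norm e)"
      using \<beta> by (intro mult_left_mono) auto
    moreover have "2 * \<epsilon> * norm e \<le> (1 - \<sigma>) * (e \<bullet> ?F y)"
    proof -
      have "2 * \<epsilon> * norm e = (1 - \<sigma>) * (c * ((\<eta> / M) * norm e))" by (simp add: \<epsilon>_def)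
      also have "\<dots> \<le> (1 - \<sigma>) * (c * (norm e * norm e))"
        using \<eta>e M assms by (intro mult_left_mono mult_right_mono) (auto simp: field_simps)
      also have "\<dots> \<le> (1 - \<sigma>) * (e \<bullet> ?F y)"
        using ce assms by (intro mult_left_mono) (auto simp: power2_eq_square)
      finally show ?thesis .
    qed
    then have "\<beta> * (2 * \<epsilon> * norm e) \<le> \<beta> * ((1 - \<sigma>) * (e \<bullet> ?F y))"
      using \<beta> by (intro mult_left_mono) auto
    ultimately have "\<psi> (y - \<beta> *\<^sub>R e) \<le> \<psi> y - \<sigma> * \<beta> * (e \<bullet> ?F y)"
      by (simp add: algebra_simps)
    moreover have "\<psi> y = phi m A y" using y by (simp add: \<psi>_def)
    moreover have "\<psi> (y - \<beta> *\<^sub>R e) = phi m A (trial_point m A B y \<beta>)"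
      by (simp add: \<psi>_def trial_point_def Let_def descent_direction_eq[OF assms(1,2)] e_def)
    ultimately show "sufficient_decrease m A \<sigma> B y \<beta>"
      by (simp add: sufficient_decrease_def e_def inner_commute)
  qed
  then show thesis by (rule that[OF b])
qed

section \<open>Accumulation points are zeros of \<open>F_map\<close>\<close>

theorem theorem2p3:
  fixes m :: nat and A :: "'n::finite tensor"
    and \<sigma> \<rho> c M :: real
    and B :: "nat \<Rightarrow> real ^ 'n ^ 'n"
    and x :: "nat \<Rightarrow> real ^ 'n" and xbar :: "real ^ 'n"
  assumes "m \<ge> 2"
    and "symmetric_tensor m A"
    and "0 < \<sigma>" and "\<sigma> < 1"
    and "0 < \<rho>" and "\<rho> < 1"
    and "\<And>k. symmetric_pos_def (B k)"
    and "general_descent_run m A \<sigma> \<rho> B x"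
    and "0 < c" and "c \<le> M"
    and "\<And>k d. c * (norm d)\<^sup>2 \<le> d \<bullet> (B k *v d) \<and> d \<bullet> (B k *v d) \<le> M * (norm d)\<^sup>2"
    and "accumulation_point x xbar"
  shows "Z_eigenvector m A (tensor_form m A xbar) xbar"
proof -
  let ?F = "F_map m A" and ?f = "phi m A"
  have m: "m \<ge> 1" and M: "0 < M" using assms by auto
  have unit: "norm (x k) = 1" for k
    by (rule general_descent_run_norm[OF assms(1,8)])
  obtain r where r: "strict_mono r" "(\<lambda>k. x (r k)) \<longlonglongrightarrow> xbar"
    using assms(12) unfolding accumulation_point_def o_def by blast
  have xbar: "norm xbar = 1"
    using tendsto_norm[OF r(2)] by (simp add: unit LIMSEQ_const_iff)
  have "\<forall>k. \<exists>\<alpha>. backtracking_step m A \<sigma> \<rho> (B k) (x k) \<alpha> \<and>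
      x (Suc k) = trial_point m A (B k) (x k) \<alpha>"
    using assms(8) by (simp add: general_descent_run_def)
  then obtain \<alpha> where \<alpha>: "\<And>k. backtracking_step m A \<sigma> \<rho> (B k) (x k) (\<alpha> k)"
    "\<And>k. x (Suc k) = trial_point m A (B k) (x k) (\<alpha> k)"
    by metis
  have \<alpha>_pos: "0 < \<alpha> k" for k
    using \<alpha>(1)[of k] assms(5) by (auto simp: backtracking_step_def)
  define q where "q k = ?F (x k) \<bullet> (matrix_inv (B k) *v ?F (x k))" for k
  have q: "(norm (?F (x k)))\<^sup>2 \<le> M * q k" for k
    unfolding q_def using inner_matrix_inv_ge[OF assms(7) M] assms(11) by blast
  have q_nonneg: "0 \<le> q k" for k
    using q[of k] M by (smt (verit) zero_le_power2 mult_pos_neg)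
  have dec: "?f (x (Suc k)) \<le> ?f (x k) - \<sigma> * \<alpha> k * q k" for k
    using \<alpha> by (simp add: backtracking_step_def sufficient_decrease_def q_def)
  have "decseq (\<lambda>k. ?f (x k))"
    using dec q_nonneg \<alpha>_pos assms(3) unfolding decseq_Suc_iff
    by (smt (verit) mult_nonneg_nonneg)
  then have dec': "j \<le> k \<Longrightarrow> ?f (x k) \<le> ?f (x j)" for j k
    by (simp add: decseq_def)
  have flim: "(\<lambda>k. ?f (x (r k))) \<longlonglongrightarrow> ?f xbar"
  proof -
    have "isCont ?f xbar"
      using GDERIV_phi[OF m assms(2)] has_derivative_continuous unfolding gderiv_def by blast
    then show ?thesis using r(2) by (rule isCont_tendsto_compose)
  qed
  \<comment> \<open>Because n \<le> r n, the subsequence eventually lies beyond index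
    \<open>k\<close>, where monotonicity puts its values below \<open>?f (x k)\<close>; the limit
    inherits this.\<close>
  have lower: "?f xbar \<le> ?f (x k)" for k
  proof (rule LIMSEQ_le_const2[OF flim])
    show "\<exists>N. \<forall>n\<ge>N. ?f (x (r n)) \<le> ?f (x k)"
      using r(1) by (meson dec' order_trans seq_suble)
  qed
  have "?F xbar = 0"
  proof (rule ccontr)
    assume nz: "?F xbar \<noteq> 0"
    obtain b where b: "0 < b"
      "\<forall>\<^sub>F y in nhds xbar. \<forall>B \<beta>. norm y = 1 \<longrightarrow> symmetric_pos_def B \<longrightarrow>
         (\<forall>d. c * (norm d)\<^sup>2 \<le> d \<bullet> (B *v d) \<and> d \<bullet> (B *v d) \<le> M * (norm d)\<^sup>2) \<longrightarrow>
         0 < \<beta> \<longrightarrow> \<beta> < b \<longrightarrow> sufficient_decrease m A \<sigma> B y \<beta>"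
      using sufficient_decrease_near[OF m assms(2,4,9,10) xbar nz] by blast
    \<comment> \<open>A single power of \<rho> below the threshold serves for all large
      \<open>k\<close>.\<close>
    obtain j where j: "\<rho> ^ j < b"
      using real_arch_pow_inv[OF b(1) assms(6)] by blast
    have "\<forall>\<^sub>F k in sequentially. sufficient_decrease m A \<sigma> (B (r k)) (x (r k)) (\<rho> ^ j)"
      using eventually_compose_filterlim[OF b(2) r(2)]
      by eventually_elim (use unit assms(5,7,11) j in auto)
    \<comment> \<open>Backtracking accepts the largest admissible power, hence one at least as large
      as this.\<close>
    then have ev1: "\<forall>\<^sub>F k in sequentially. \<rho> ^ j \<le> \<alpha> (r k)"
      by eventually_elim (use \<alpha>(1) in \<open>auto simp: backtracking_step_def\<close>)
    have "(\<lambda>k. ?F (x (r k))) \<longlonglongrightarrow> ?F xbar"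
      using continuous_on_F_map[of UNIV m A] r(2)
      by (auto simp: continuous_on_eq_continuous_at intro: isCont_tendsto_compose)
    then have "(\<lambda>k. norm (?F (x (r k)))) \<longlonglongrightarrow> norm (?F xbar)"
      by (rule tendsto_norm)
    then have ev2: "\<forall>\<^sub>F k in sequentially. norm (?F xbar) / 2 < norm (?F (x (r k)))"
      using nz by (intro order_tendstoD) auto
    \<comment> \<open>The guaranteed drop in one step when the step length is at least \<rho>^j and
      the norm of \<open>F_map\<close> exceeds half its limit.\<close>
    define \<gamma> where "\<gamma> = \<sigma> * \<rho> ^ j * ((norm (?F xbar) / 2)\<^sup>2 / M)"
    have "0 < \<gamma>" using nz assms M by (simp add: \<gamma>_def)
    then have "\<forall>\<^sub>F k in sequentially. ?f (x (r k)) < ?f xbar + \<gamma>"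
      by (intro order_tendstoD[OF flim]) auto
    \<comment> \<open>From a value below \<open>?f xbar + \<gamma>\<close>, a drop of at least
      \<gamma> leads below \<open>?f xbar\<close>, against \<open>lower\<close>.\<close>
    with ev1 ev2 have "\<forall>\<^sub>F k::nat in sequentially. False"
    proof eventually_elim
      fix k
      assume k: "\<rho> ^ j \<le> \<alpha> (r k)" "norm (?F xbar) / 2 < norm (?F (x (r k)))"
        "?f (x (r k)) < ?f xbar + \<gamma>"
      have "(norm (?F xbar) / 2)\<^sup>2 \<le> M * q (r k)"
        using k(2) by (intro order_trans[OF power_mono q]) auto
      then have "(norm (?F xbar) / 2)\<^sup>2 / M \<le> q (r k)"
        using M by (simp add: pos_divide_le_eq mult.commute)
      then have "\<gamma> \<le> \<sigma> * \<alpha> (r k) * q (r k)"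
        unfolding \<gamma>_def using k(1) assms(3,5) \<alpha>_pos[of "r k"] M
        by (intro mult_mono mult_left_mono) auto
      then show False
        using dec[of "r k"] lower[of "Suc (r k)"] k(3) by linarith
    qed
    then show False by simp
  qed
  then show ?thesis
    using xbar by (simp add: Z_eigenvector_def F_map_def norm_eq_1)
qed

end
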